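(* Assume that $K$ is a p.c.f. self-similar set. For $f\in L^1(K,\mu)$ and any $t>0$, we have $$\mu\left(\left\{x\in K: M_{\mathcal{D}}^\mu f(x)>t\right\}\right)\le \frac{4}{t}\int_K |f(x)|\,d\mu.$$
   Context: Self-similar set and measure. For $1\le i\le m$ let $S_i:\mathbb{R}^d\to\mathbb{R}^d$, $S_i(x)=r_iR_i(x)+b_i$ with $0<r_i<1$, $b_i\in\mathbb{R}^d$, $R_i$ orthogonal. $K\subset\mathbb{R}^d$ is the unique nonempty compact set with $K=\bigcup_{i=1}^m S_i(K)$ (the self-similar set generated by $\{S_i\}_{i=1}^m$). It is always assumed that the $S_i$ do not all share a common fixed point. Given a probability vector $(p_1,\dots,p_m)$ with all $p_i>0$ and $\sum_i p_i=1$, $\mu$ is the unique Borel probability measure with $\mu=\sum_{i=1}^m p_i\,\mu\circ S_i^{-1}$ (self-similar measure; it is supported on $K$). Basic cubes. $\Sigma_n=\{1,\dots,m\}^n$ for $n\ge1$. For $\mathbf{i}=i_1\ldots i_n$, $S_{\mathbf{i}}=S_{i_1}\circ\cdots\circ S_{i_n}$ and $K_{\mathbf{i}}=S_{\mathbf{i}}(K)$. $\mathcal{D}$ is the collection consisting of $K$ and all $K_{\mathbf{i}}$, $\mathbf{i}\in\Sigma_n$, $n\ge1$ (basic cubes). P.c.f. Let $\Sigma_\infty=\{1,\dots,m\}^{\mathbb{N}}$, let $\Pi:\Sigma_\infty\to K$ be the coding map, $\{\Pi(\mathbf{i})\}=\bigcap_{n\ge1}K_{i_1\ldots i_n}$,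 and let $\sigma$ be the shift $\sigma(i_1,i_2,\dots)=(i_2,i_3,\dots)$. Put $\mathcal{C}_K=\bigcup_{i\ne j}(S_i(K)\cap S_j(K))$ and $\mathcal{C}=\Pi^{-1}(\mathcal{C}_K)$. $K$ is post-critically finite (p.c.f.) if $\bigcup_{n\ge1}\sigma^n(\mathcal{C})$ is a finite set. Maximal operator. $M_{\mathcal{D}}^\mu f(x)=\sup\frac{1}{\mu(K_{\mathbf{i}})}\int_{K_{\mathbf{i}}}|f|\,d\mu$ for $x\in K$, the supremum being over all $n\in\mathbb{N}=\{1,2,\dots\}$ and all $\mathbf{i}\in\Sigma_n$ with $x\in K_{\mathbf{i}}$. *)

theory Defs
  imports "HOL-Probability.Probability"
begin

text \<open>Iterated function systems are families \<open>S :: nat \<Rightarrow> 'a \<Rightarrow> 'a\<close> of which only the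
  members with index in \<open>{1..m}\<close> matter. The attractor and the invariant measure are
  characterised by predicates; for contractive similitudes each of them exists and is unique.\<close>

definition self_similar_set :: "nat \<Rightarrow> (nat \<Rightarrow> 'a \<Rightarrow> 'a) \<Rightarrow> 'a::euclidean_space set \<Rightarrow> bool" where
  "self_similar_set m S K \<longleftrightarrow> K \<noteq> {} \<and> compact K \<and> K = (\<Union>i\<in>{1..m}. S i ` K)"

text \<open>The measure lives on the whole space (so that the preimages below need no relativisation).\<close>

definition self_similar_measure ::
    "nat \<Rightarrow> (nat \<Rightarrow> 'a \<Rightarrow> 'a) \<Rightarrow> (nat \<Rightarrow> real) \<Rightarrow> 'a::euclidean_space measure \<Rightarrow> bool" where
  "self_similar_measure m S p \<mu> \<longleftrightarrow> prob_space \<mu> \<and> sets \<mu> = sets borel \<and>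
     (\<forall>A\<in>sets borel. measure \<mu> A = (\<Sum>i\<in>{1..m}. p i * measure \<mu> (S i -` A)))"

definition words :: "nat \<Rightarrow> nat \<Rightarrow> nat list set" where
  "words m n = {w. length w = n \<and> set w \<subseteq> {1..m}}"

definition word_map :: "(nat \<Rightarrow> 'a \<Rightarrow> 'a) \<Rightarrow> nat list \<Rightarrow> 'a \<Rightarrow> 'a" where
  "word_map S w = foldr (\<circ>) (map S w) id"

definition basic_cube :: "(nat \<Rightarrow> 'a \<Rightarrow> 'a) \<Rightarrow> 'a set \<Rightarrow> nat list \<Rightarrow> 'a set" where
  "basic_cube S K w = word_map S w ` K"

text \<open>Infinite words are indexed from 0: the letter \<open>i\<^sub>k\<close> is \<open>s (k - 1)\<close>, and the prefix
  \<open>i\<^sub>1 \<dots> i\<^sub>n\<close> is \<open>map s [0..<n]\<close>.\<close>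

definition infinite_words :: "nat \<Rightarrow> (nat \<Rightarrow> nat) set" where
  "infinite_words m = {s. \<forall>k. s k \<in> {1..m}}"

definition coding_map :: "(nat \<Rightarrow> 'a \<Rightarrow> 'a) \<Rightarrow> 'a set \<Rightarrow> (nat \<Rightarrow> nat) \<Rightarrow> 'a" where
  "coding_map S K s = (THE x. (\<Inter>n\<in>{1..}. basic_cube S K (map s [0..<n])) = {x})"

definition shift :: "(nat \<Rightarrow> nat) \<Rightarrow> nat \<Rightarrow> nat" where
  "shift s = (\<lambda>k. s (Suc k))"

definition overlap_set :: "nat \<Rightarrow> (nat \<Rightarrow> 'a \<Rightarrow> 'a) \<Rightarrow> 'a set \<Rightarrow> 'a set" where
  "overlap_set m S K = (\<Union>i\<in>{1..m}. \<Union>j\<in>{1..m} - {i}. S i ` K \<inter> S j ` K)"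

definition critical_set :: "nat \<Rightarrow> (nat \<Rightarrow> 'a \<Rightarrow> 'a) \<Rightarrow> 'a set \<Rightarrow> (nat \<Rightarrow> nat) set" where
  "critical_set m S K = {s \<in> infinite_words m. coding_map S K s \<in> overlap_set m S K}"

definition post_critically_finite :: "nat \<Rightarrow> (nat \<Rightarrow> 'a \<Rightarrow> 'a) \<Rightarrow> 'a set \<Rightarrow> bool" where
  "post_critically_finite m S K \<longleftrightarrow> finite (\<Union>n\<in>{1..}. (shift ^^ n) ` critical_set m S K)"

text \<open>The supremum may be infinite, hence the type \<open>ennreal\<close>.\<close>

definition maximal_operator ::
    "nat \<Rightarrow> (nat \<Rightarrow> 'a \<Rightarrow> 'a) \<Rightarrow> 'a set \<Rightarrow> 'a measure \<Rightarrow> ('a \<Rightarrow> real) \<Rightarrow> 'a \<Rightarrow> ennreal" where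
  "maximal_operator m S K \<mu> f x =
     (SUP w \<in> {w \<in> (\<Union>n\<in>{1..}. words m n). x \<in> basic_cube S K w}.
        (\<integral>\<^sup>+y\<in>basic_cube S K w. ennreal \<bar>f y\<bar> \<partial>\<mu>) / emeasure \<mu> (basic_cube S K w))"

end

theory Submission
  imports Defs "HOL-Library.Sublist"
begin

text \<open>
  The basic cubes behave like dyadic cubes: two of them are nested or meet in a \<open>\<mu>\<close>-null set.
  If neither of two words is a prefix of the other, they split at some letter, so up to an
  injective map their cubes meet inside the overlap set of the first-level cubes. Post-critical
  finiteness makes the overlap set finite: the shift loses only one letter, hence the critical set
  is finite, and every overlap point is coded by a critical word. Finite sets are null because
  \<open>\<mu>\<close> has no atoms: the finitely many points of maximal mass would be permuted by every
  contraction \<open>S i\<close>, so there would be only one such point, a common fixed point of all maps.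

  The set where the maximal function exceeds \<open>t\<close> is the union of the cubes over which
  the average of \<open>\<bar>f\<bar>\<close> exceeds \<open>t\<close>. The cubes of the prefix-minimal words among these have the
  same union and are pairwise disjoint up to null sets, so the inequalities
  \<open>t \<mu>(K\<^sub>w) \<le> \<integral>\<^bsub>K\<^sub>w\<^esub> \<bar>f\<bar>\<close> can be added without loss. This gives the weak-type bound with
  constant \<open>1\<close> in place of \<open>4\<close>.
\<close>

section \<open>Words and basic cubes\<close>

lemma word_map_Nil [simp]: "word_map S [] = id"
  by (simp add: word_map_def)

lemma word_map_append: "word_map S (u @ v) = word_map S u \<circ> word_map S v"
  by (induction u) (simp_all add: word_map_def o_assoc)

lemma word_map_Cons: "word_map S (i # w) = S i \<circ> word_map S w"
  by (simp add: word_map_def)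

lemma basic_cube_append: "basic_cube S K (u @ v) = word_map S u ` basic_cube S K v"
  by (simp add: basic_cube_def word_map_append image_comp)

lemma countable_words: "countable (\<Union>n. words m n)"
proof -
  have "(\<Union>n. words m n) \<subseteq> lists {1..m}"
    by (auto simp: words_def)
  then show ?thesis
    by (meson countable_lists countable_finite finite_atLeastAtMost countable_subset)
qed

text \<open>A shortest prefix lying in \<open>W\<close> is minimal.\<close>

lemma minimal_prefix_exists:
  assumes "w \<in> W"
  obtains v where "v \<in> W" "prefix v w" "\<And>u. u \<in> W \<Longrightarrow> prefix u v \<Longrightarrow> u = v"
proof -
  have "\<exists>v. (v \<in> W \<and> prefix v w) \<and> (\<forall>u. u \<in> W \<and> prefix u w \<longrightarrow> length v \<le> length u)"
    using assms by (intro ex_has_least_nat[of _ w]) auto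
  then obtain v where v: "v \<in> W" "prefix v w"
    and least: "\<And>u. u \<in> W \<Longrightarrow> prefix u w \<Longrightarrow> length v \<le> length u"
    by blast
  have "u = v" if u: "u \<in> W" "prefix u v" for u
    using least[OF u(1) prefix_order.trans[OF u(2) v(2)]] u(2) by (auto simp: prefix_def)
  with v show thesis
    using that by blast
qed

section \<open>Coding and overlaps of a contracting system\<close>

text \<open>Finitely many similitudes with ratios in \<open>(0, 1)\<close> form such a system, with \<open>c\<close> the largest
  ratio. Contraction makes codes determine points; injectivity lets intersections be computed
  before a map is applied.\<close>

locale contracting_system =
  fixes m :: nat and S :: "nat \<Rightarrow> 'a::euclidean_space \<Rightarrow> 'a" and K :: "'a set" and c :: real
  assumes c_nonneg: "0 \<le> c" and c_less_1: "c < 1"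
    and contract: "i \<in> {1..m} \<Longrightarrow> dist (S i x) (S i y) \<le> c * dist x y"
    and inj_map: "i \<in> {1..m} \<Longrightarrow> inj (S i)"
    and attractor: "self_similar_set m S K"
begin

lemma K_eq: "K = (\<Union>i\<in>{1..m}. S i ` K)" and compact_K: "compact K"
  using attractor by (auto simp: self_similar_set_def)

lemma inj_word_map: "set w \<subseteq> {1..m} \<Longrightarrow> inj (word_map S w)"
  by (induction w) (auto simp: word_map_Cons intro!: inj_compose inj_map)

lemma dist_word_map:
  "set w \<subseteq> {1..m} \<Longrightarrow> dist (word_map S w x) (word_map S w y) \<le> c ^ length w * dist x y"
proof (induction w)
  case (Cons i w)
  have "dist (word_map S (i # w) x) (word_map S (i # w) y)
      \<le> c * dist (word_map S w x) (word_map S w y)"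
    using Cons.prems by (simp add: word_map_Cons contract)
  also have "\<dots> \<le> c * (c ^ length w * dist x y)"
    using Cons c_nonneg by (intro mult_left_mono) auto
  finally show ?case
    by (simp add: mult.assoc)
qed simp

lemma continuous_on_map: "i \<in> {1..m} \<Longrightarrow> continuous_on A (S i)"
  using contract c_nonneg by (intro lipschitz_on_continuous_on[of c] lipschitz_onI) auto

lemma compact_basic_cube: "set w \<subseteq> {1..m} \<Longrightarrow> compact (basic_cube S K w)"
proof (induction w)
  case (Cons i w)
  have "basic_cube S K (i # w) = S i ` basic_cube S K w"
    by (simp add: basic_cube_def word_map_Cons image_comp)
  then show ?case
    using Cons by (auto intro!: compact_continuous_image continuous_on_map)
qed (simp add: basic_cube_def compact_K)

lemma basic_cube_subset: "set w \<subseteq> {1..m} \<Longrightarrow> basic_cube S K w \<subseteq> K"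
proof (induction w)
  case (Cons i w)
  have "basic_cube S K (i # w) = S i ` basic_cube S K w"
    by (simp add: basic_cube_def word_map_Cons image_comp)
  also have "\<dots> \<subseteq> S i ` K"
    using Cons by (intro image_mono) auto
  also have "\<dots> \<subseteq> K"
    using Cons.prems by (subst (2) K_eq) auto
  finally show ?case .
qed (simp add: basic_cube_def)

lemma basic_cube_mono:
  assumes "prefix u w" "set w \<subseteq> {1..m}"
  shows "basic_cube S K w \<subseteq> basic_cube S K u"
proof -
  obtain v where w: "w = u @ v"
    using assms(1) by (auto simp: prefix_def)
  then have "basic_cube S K v \<subseteq> K"
    using assms(2) by (intro basic_cube_subset) auto
  then show ?thesis
    unfolding w basic_cube_append by (auto simp: basic_cube_def)
qed

text \<open>A code of \<open>x\<close> is read off by repeatedly choosing a first-level cube that contains the current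
  point and moving to a preimage in \<open>K\<close> under the corresponding map.\<close>

lemma point_has_code:
  assumes "x \<in> K"
  obtains s where "s \<in> infinite_words m" "\<And>n. x \<in> basic_cube S K (map s [0..<n])"
proof -
  have "\<forall>y\<in>K. \<exists>i z. i \<in> {1..m} \<and> z \<in> K \<and> S i z = y"
    by (subst K_eq) blast
  then obtain i g where ig: "\<And>y. y \<in> K \<Longrightarrow> i y \<in> {1..m} \<and> g y \<in> K \<and> S (i y) (g y) = y"
    by metis
  define s where "s k = i ((g ^^ k) x)" for k
  have orbit: "(g ^^ k) x \<in> K" for k
    using assms ig by (induction k) auto
  have "word_map S (map s [0..<n]) ((g ^^ n) x) = x" for n
  proof (induction n)
    case (Suc n)
    have "S (s n) ((g ^^ Suc n) x) = (g ^^ n) x"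
      using ig[OF orbit[of n]] by (simp add: s_def)
    then show ?case
      using Suc by (simp add: word_map_append word_map_Cons)
  qed simp
  then have "x \<in> basic_cube S K (map s [0..<n])" for n
    unfolding basic_cube_def using orbit[of n] by (metis imageI)
  moreover have "s \<in> infinite_words m"
    using ig[OF orbit] by (auto simp: infinite_words_def s_def)
  ultimately show thesis
    using that by blast
qed

text \<open>The cubes along an infinite word shrink geometrically, so they have at most one common point,
  and the definite description in the coding map is satisfied.\<close>

lemma coding_map_eqI:
  assumes s: "s \<in> infinite_words m" and x: "\<And>n. x \<in> basic_cube S K (map s [0..<n])"
  shows "coding_map S K s = x"
proof -
  obtain D where D: "\<And>y z. y \<in> K \<Longrightarrow> z \<in> K \<Longrightarrow> dist y z \<le> D"
    using compact_imp_bounded[OF compact_K] by (auto simp: bounded_two_points)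
  have "z = x" if z: "\<And>n. n \<ge> 1 \<Longrightarrow> z \<in> basic_cube S K (map s [0..<n])" for z
  proof -
    have le: "dist z x \<le> c ^ n * D" if n: "n \<ge> 1" for n
    proof -
      let ?w = "map s [0..<n]"
      have w: "set ?w \<subseteq> {1..m}"
        using s by (auto simp: infinite_words_def)
      obtain y y' where y: "y \<in> K" "z = word_map S ?w y" and y': "y' \<in> K" "x = word_map S ?w y'"
        using z[OF n] x[of n] by (auto simp: basic_cube_def)
      have "dist z x \<le> c ^ n * dist y y'"
        using dist_word_map[OF w, of y y'] y y' by simp
      also have "\<dots> \<le> c ^ n * D"
        using D[OF y(1) y'(1)] c_nonneg by (intro mult_left_mono) auto
      finally show ?thesis .
    qed
    have "(\<lambda>n. c ^ n * D) \<longlonglongrightarrow> 0 * D"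
      using c_nonneg c_less_1 by (intro tendsto_intros LIMSEQ_realpow_zero) auto
    then have "dist z x \<le> 0 * D"
      by (rule LIMSEQ_le_const) (use le in blast)
    then show ?thesis
      by simp
  qed
  then have "(\<Inter>n\<in>{1..}. basic_cube S K (map s [0..<n])) = {x}"
    using x by auto
  then show ?thesis
    by (simp add: coding_map_def)
qed

text \<open>A word is determined by its first letter and its shift, so finiteness of the first shift of
  the critical set already bounds the critical set itself.\<close>

lemma finite_overlap_set:
  assumes "post_critically_finite m S K"
  shows "finite (overlap_set m S K)"
proof -
  let ?C = "critical_set m S K"
  have "shift ` ?C \<subseteq> (\<Union>n\<in>{1..}. (shift ^^ n) ` ?C)"
    by (intro UN_upper[of "1::nat", THEN subset_trans[rotated]]) auto
  then have "finite (shift ` ?C)"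
    using assms unfolding post_critically_finite_def by (rule finite_subset)
  then have "finite ((\<lambda>(i, u). case_nat i u) ` ({1..m} \<times> shift ` ?C))"
    by blast
  moreover have "?C \<subseteq> (\<lambda>(i, u). case_nat i u) ` ({1..m} \<times> shift ` ?C)"
  proof
    fix s assume s: "s \<in> ?C"
    have "s = (\<lambda>(i, u). case_nat i u) (s 0, shift s)"
      by (auto simp: shift_def fun_eq_iff split: nat.splits)
    moreover have "s 0 \<in> {1..m}"
      using s by (auto simp: critical_set_def infinite_words_def)
    ultimately show "s \<in> (\<lambda>(i, u). case_nat i u) ` ({1..m} \<times> shift ` ?C)"
      using s by blast
  qed
  ultimately have "finite ?C"
    by (rule rev_finite_subset)
  moreover have "overlap_set m S K \<subseteq> coding_map S K ` ?C"
  proof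
    fix x assume x: "x \<in> overlap_set m S K"
    then have "x \<in> K"
      using K_eq by (auto simp: overlap_set_def)
    then obtain s where s: "s \<in> infinite_words m" "\<And>n. x \<in> basic_cube S K (map s [0..<n])"
      using point_has_code by blast
    then have "coding_map S K s = x"
      by (rule coding_map_eqI)
    with s x show "x \<in> coding_map S K ` ?C"
      by (force simp: critical_set_def)
  qed
  ultimately show ?thesis
    by (meson finite_imageI finite_subset)
qed

text \<open>At the letter where the two words split, the cubes lie in different first-level cubes; the map
  of the common prefix carries the finite overlap set over their intersection.\<close>

lemma finite_cube_intersection:
  assumes pcf: "post_critically_finite m S K"
    and u: "set u \<subseteq> {1..m}" and v: "set v \<subseteq> {1..m}" and "u \<parallel> v"
  shows "finite (basic_cube S K u \<inter> basic_cube S K v)"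
proof -
  obtain a i x j y where split: "i \<noteq> j" "u = a @ i # x" "v = a @ j # y"
    using parallel_decomp[OF \<open>u \<parallel> v\<close>] by blast
  have first_level: "basic_cube S K (k # z) \<subseteq> S k ` K" if "set z \<subseteq> {1..m}" for k z
    using basic_cube_subset[OF that] by (auto simp: basic_cube_def word_map_Cons)
  have ij: "i \<in> {1..m}" "j \<in> {1..m}"
    using u v split by auto
  have "basic_cube S K (i # x) \<inter> basic_cube S K (j # y) \<subseteq> S i ` K \<inter> S j ` K"
    using first_level[of x i] first_level[of y j] u v split by auto
  also have "\<dots> \<subseteq> overlap_set m S K"
    using ij \<open>i \<noteq> j\<close> unfolding overlap_set_def by blast
  finally have "finite (basic_cube S K (i # x) \<inter> basic_cube S K (j # y))"
    using finite_overlap_set[OF pcf] finite_subset by blast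
  moreover have "basic_cube S K u \<inter> basic_cube S K v
      = word_map S a ` (basic_cube S K (i # x) \<inter> basic_cube S K (j # y))"
    using u split by (simp add: basic_cube_append image_Int inj_word_map)
  ultimately show ?thesis
    by simp
qed

section \<open>Absence of atoms\<close>

text \<open>If there is an atom, some point has maximal mass, and only finitely many do. The mass of such a
  point is a weighted average, with positive weights, of the masses of its fibres under the maps,
  each of which has at most one point. Hence every fibre is again a point of maximal mass. Pulling
  back two such points at the largest possible distance contradicts contraction unless they
  coincide, and a single point of maximal mass is fixed by all maps.\<close>

lemma self_similar_measure_singleton:
  assumes p_pos: "\<And>i. i \<in> {1..m} \<Longrightarrow> 0 < p i" and p_sum: "(\<Sum>i\<in>{1..m}. p i) = 1"
    and invariant: "self_similar_measure m S p \<mu>"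
    and no_fixed: "\<not> (\<exists>x. \<forall>i\<in>{1..m}. S i x = x)"
  shows "measure \<mu> {x} = 0"
proof (rule ccontr)
  assume atom: "measure \<mu> {x} \<noteq> 0"
  interpret prob_space \<mu>
    using invariant by (simp add: self_similar_measure_def)
  have sets: "sets \<mu> = sets borel"
    using invariant by (simp add: self_similar_measure_def)
  define e where "e = prob {x}"
  define B where "B = {y. e \<le> prob {y}}"
  have "0 < e"
    using atom by (simp add: e_def zero_less_measure_iff)
  \<comment> \<open>Restricting to points at least as heavy as the given atom leaves finitely many candidates, so
    the supremum of the point masses is attained.\<close>
  have card_le: "card F * e \<le> 1" if "finite F" "F \<subseteq> B" for F
  proof -
    have "card F * e = (\<Sum>y\<in>F. e)"
      by simp
    also have "\<dots> \<le> (\<Sum>y\<in>F. prob {y})"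
      using that by (intro sum_mono) (auto simp: B_def)
    also have "\<dots> = prob F"
      using that by (intro finite_measure_eq_sum_singleton[symmetric]) (auto simp: sets)
    finally show ?thesis
      using prob_le_1[of F] by linarith
  qed
  have "finite B"
  proof (rule finite_if_finite_subsets_card_bdd[of _ "nat \<lfloor>1 / e\<rfloor>", THEN conjunct1])
    fix F assume "F \<subseteq> B" "finite F"
    then show "card F \<le> nat \<lfloor>1 / e\<rfloor>"
      using card_le[of F] \<open>0 < e\<close> by (simp add: le_nat_floor field_simps)
  qed
  have "x \<in> B"
    by (simp add: B_def e_def)
  define a where "a = Max ((\<lambda>y. prob {y}) ` B)"
  have a: "a \<in> (\<lambda>y. prob {y}) ` B"
    unfolding a_def using \<open>finite B\<close> \<open>x \<in> B\<close> by (intro Max_in) auto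
  have le_a: "prob {y} \<le> a" if "y \<in> B" for y
    unfolding a_def using \<open>finite B\<close> that by (intro Max_ge) auto
  have "e \<le> a"
    using le_a[OF \<open>x \<in> B\<close>] by (simp add: e_def)
  have max: "prob {y} \<le> a" for y
    using le_a[of y] \<open>e \<le> a\<close> by (cases "y \<in> B") (auto simp: B_def)
  define A where "A = {y. prob {y} = a}"
  have "A \<subseteq> B"
    using \<open>e \<le> a\<close> by (auto simp: A_def B_def)
  then have "finite A"
    using \<open>finite B\<close> finite_subset by blast
  have "A \<noteq> {}"
    using a by (auto simp: A_def)
  have preimage: "\<exists>z\<in>A. S i z = y" if "y \<in> A" and i: "i \<in> {1..m}" for y i
  proof -
    have fibre: "S j -` {y} = {} \<or> (\<exists>z. S j -` {y} = {z} \<and> S j z = y)" if "j \<in> {1..m}" for j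
    proof (cases "S j -` {y} = {}")
      case False
      then obtain z where z: "S j z = y"
        by blast
      then have "S j -` {y} = {z}"
        using injD[OF inj_map[OF that]] by auto
      with z show ?thesis
        by blast
    qed simp
    have le: "prob (S j -` {y}) \<le> a" if "j \<in> {1..m}" for j
      using fibre[OF that] max \<open>0 < e\<close> \<open>e \<le> a\<close> by auto
    have "(\<Sum>j\<in>{1..m}. p j * prob (S j -` {y})) = prob {y}"
      using invariant by (simp add: self_similar_measure_def)
    also have "\<dots> = (\<Sum>j\<in>{1..m}. p j * a)"
      using \<open>y \<in> A\<close> p_sum by (simp add: A_def flip: sum_distrib_right)
    finally have "(\<Sum>j\<in>{1..m}. p j * (a - prob (S j -` {y}))) = 0"
      by (simp add: right_diff_distrib sum_subtractf)
    then have "p i * (a - prob (S i -` {y})) = 0"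
      using i le p_pos by (subst (asm) sum_nonneg_eq_0_iff) (auto simp: less_imp_le)
    then have "prob (S i -` {y}) = a"
      using p_pos[OF i] by simp
    then show ?thesis
      using fibre[OF i] \<open>0 < e\<close> \<open>e \<le> a\<close> by (auto simp: A_def)
  qed
  have "{1..m} \<noteq> {}"
    using p_sum by force
  then obtain i where i: "i \<in> {1..m}"
    by blast
  obtain y z where yz: "y \<in> A" "z \<in> A"
    and far: "\<And>y' z'. y' \<in> A \<Longrightarrow> z' \<in> A \<Longrightarrow> dist y' z' \<le> dist y z"
    using compact_sup_maxdistance[OF finite_imp_compact[OF \<open>finite A\<close>] \<open>A \<noteq> {}\<close>] by blast
  obtain y' z' where "y' \<in> A" "S i y' = y" "z' \<in> A" "S i z' = z"
    using preimage i yz by metis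
  then have "dist y z \<le> c * dist y z"
    using contract[OF i, of y' z'] far[of y' z'] c_nonneg
    by (metis mult_left_mono order_trans)
  then have "(1 - c) * dist y z \<le> 0"
    by (simp add: algebra_simps)
  then have "dist y z = 0"
    using c_less_1 by (simp add: mult_le_0_iff)
  then have "\<And>y'. y' \<in> A \<Longrightarrow> y' = y"
    using far yz by (metis dist_le_zero_iff)
  then have "\<forall>i\<in>{1..m}. S i y = y"
    using preimage yz(1) by metis
  with no_fixed show False
    by blast
qed

end

section \<open>The weak-type inequality\<close>

lemma divide_times_le_ennreal: "a / b * b \<le> (a :: ennreal)"
  by (cases "b = 0 \<or> b = \<top>") (auto simp: ennreal_divide_times top.not_eq_extremum)

text \<open>Removing the null set \<open>N\<close> makes the sets \<open>A i\<close> disjoint and changes neither side.\<close>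

lemma weak_type_UN:
  fixes g :: "'a \<Rightarrow> ennreal"
  assumes I: "countable I" and A: "\<And>i. i \<in> I \<Longrightarrow> A i \<in> sets M"
    and g: "g \<in> borel_measurable M" and N: "N \<in> null_sets M"
    and overlap: "\<And>i j. i \<in> I \<Longrightarrow> j \<in> I \<Longrightarrow> i \<noteq> j \<Longrightarrow> A i \<inter> A j \<subseteq> N"
    and large: "\<And>i. i \<in> I \<Longrightarrow> t * emeasure M (A i) \<le> (\<integral>\<^sup>+x\<in>A i. g x \<partial>M)"
  shows "t * emeasure M (\<Union>i\<in>I. A i) \<le> (\<integral>\<^sup>+x\<in>(\<Union>i\<in>I. A i). g x \<partial>M)"
proof -
  define \<nu> where "\<nu> = density M g"
  define E where "E i = A i - N" for i
  have E: "E i \<in> sets M" if "i \<in> I" for i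
    using A[OF that] N by (auto simp: E_def)
  have disj: "disjoint_family_on E I"
    using overlap by (fastforce simp: disjoint_family_on_def E_def)
  have U: "(\<Union>i\<in>I. A i) \<in> sets M"
    using I A by blast
  have nu: "emeasure \<nu> X = (\<integral>\<^sup>+x\<in>X. g x \<partial>M)" if "X \<in> sets M" for X
    unfolding \<nu>_def using g that by (rule emeasure_density)
  have "N \<in> null_sets \<nu>"
    using N absolutely_continuousI_density[OF g] by (auto simp: absolutely_continuous_def \<nu>_def)
  then have nu_diff: "emeasure \<nu> (X - N) = emeasure \<nu> X" if "X \<in> sets M" for X
    using that by (intro emeasure_Diff_null_set) (auto simp: \<nu>_def)
  have step: "t * emeasure M (E i) \<le> emeasure \<nu> (E i)" if "i \<in> I" for i
    using large[OF that] A[OF that] N by (simp add: E_def emeasure_Diff_null_set nu nu_diff)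
  have UE: "(\<Union>i\<in>I. E i) = (\<Union>i\<in>I. A i) - N"
    by (auto simp: E_def)
  have "t * emeasure M (\<Union>i\<in>I. A i) = t * emeasure M (\<Union>i\<in>I. E i)"
    using N U by (simp add: UE emeasure_Diff_null_set)
  also have "\<dots> = (\<integral>\<^sup>+i. t * emeasure M (E i) \<partial>count_space I)"
    using I E disj by (simp add: emeasure_UN_countable nn_integral_cmult)
  also have "\<dots> \<le> (\<integral>\<^sup>+i. emeasure \<nu> (E i) \<partial>count_space I)"
    by (intro nn_integral_mono) (simp add: step)
  also have "\<dots> = emeasure \<nu> (\<Union>i\<in>I. E i)"
    using I E disj by (intro emeasure_UN_countable[symmetric]) (auto simp: \<nu>_def)
  also have "\<dots> = emeasure \<nu> (\<Union>i\<in>I. A i)"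
    using U by (simp add: UE nu_diff)
  finally show ?thesis
    using U by (simp add: nu)
qed

text \<open>The prefix-minimal words among those with a large average form an antichain, and passing to
  them loses no point because the cube of a word lies in the cubes of its prefixes.\<close>

lemma (in contracting_system) maximal_operator_weak_type:
  assumes pcf: "post_critically_finite m S K"
    and sets: "sets \<mu> = sets borel"
    and atomless: "\<And>x. emeasure \<mu> {x} = 0"
    and f: "set_borel_measurable \<mu> K f"
  shows "ennreal t * emeasure \<mu> {x \<in> K. maximal_operator m S K \<mu> f x > ennreal t}
    \<le> (\<integral>\<^sup>+x\<in>K. ennreal \<bar>f x\<bar> \<partial>\<mu>)"
proof -
  define Q where "Q w = basic_cube S K w" for w
  define g where "g x = ennreal \<bar>indicator K x *\<^sub>R f x\<bar>" for x
  define W where "W = {w \<in> (\<Union>n\<in>{1..}. words m n).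
    (\<integral>\<^sup>+y\<in>Q w. ennreal \<bar>f y\<bar> \<partial>\<mu>) / emeasure \<mu> (Q w) > ennreal t}"
  define V where "V = {v \<in> W. \<forall>u\<in>W. prefix u v \<longrightarrow> u = v}"
  have letters: "set w \<subseteq> {1..m}" if "w \<in> W" for w
    using that by (auto simp: W_def words_def)
  have W_countable: "countable W"
    by (rule countable_subset[OF _ countable_words[of m]]) (auto simp: W_def)
  have V_W: "V \<subseteq> W"
    by (auto simp: V_def)
  have V_countable: "countable V"
    using V_W W_countable countable_subset by blast
  have Q_sets: "Q w \<in> sets \<mu>" if "w \<in> W" for w
    unfolding Q_def sets using compact_basic_cube[OF letters[OF that]] borel_compact by blast
  have Q_K: "Q w \<subseteq> K" if "w \<in> W" for w
    unfolding Q_def using letters[OF that] by (rule basic_cube_subset)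
  have g_meas: "g \<in> borel_measurable \<mu>"
    using f unfolding g_def set_borel_measurable_def by measurable

  have "{x \<in> K. maximal_operator m S K \<mu> f x > ennreal t} = (\<Union>w\<in>W. Q w)"
    using Q_K by (fastforce simp: maximal_operator_def less_SUP_iff W_def Q_def)
  also have "\<dots> = (\<Union>v\<in>V. Q v)"
  proof (intro equalityI UN_least)
    fix w assume w: "w \<in> W"
    obtain v where v: "v \<in> W" "prefix v w" "\<And>u. u \<in> W \<Longrightarrow> prefix u v \<Longrightarrow> u = v"
      using minimal_prefix_exists[OF w] by blast
    then have "v \<in> V"
      by (auto simp: V_def)
    moreover have "Q w \<subseteq> Q v"
      unfolding Q_def using v(2) letters[OF w] by (rule basic_cube_mono)
    ultimately show "Q w \<subseteq> (\<Union>v\<in>V. Q v)"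
      by blast
  qed (use V_W in blast)
  finally have level_set: "{x \<in> K. maximal_operator m S K \<mu> f x > ennreal t} = (\<Union>v\<in>V. Q v)" .

  define N where "N = (\<Union>(u, v) \<in> {(u, v) \<in> V \<times> V. u \<noteq> v}. Q u \<inter> Q v)"
  have "countable N"
    unfolding N_def
  proof (rule countable_UN)
    show "countable {(u, v) \<in> V \<times> V. u \<noteq> v}"
      by (rule countable_subset[of _ "V \<times> V"]) (auto simp: V_countable)
  next
    fix uv assume "uv \<in> {(u, v) \<in> V \<times> V. u \<noteq> v}"
    then obtain u v where uv: "uv = (u, v)" "u \<in> V" "v \<in> V" "u \<noteq> v"
      by blast
    then have "u \<parallel> v"
      by (auto simp: V_def parallel_def)
    then have "finite (Q u \<inter> Q v)"
      unfolding Q_def using uv V_W letters by (intro finite_cube_intersection[OF pcf]) auto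
    then show "countable (case uv of (u, v) \<Rightarrow> Q u \<inter> Q v)"
      using uv by (simp add: countable_finite)
  qed
  then have "(\<Union>x\<in>N. {x}) \<in> null_sets \<mu>"
    using atomless by (intro null_sets_UN') (auto simp: null_sets_def sets)
  then have N_null: "N \<in> null_sets \<mu>"
    by simp

  have large: "ennreal t * emeasure \<mu> (Q w) \<le> (\<integral>\<^sup>+x\<in>Q w. g x \<partial>\<mu>)" if w: "w \<in> W" for w
  proof -
    have "(\<integral>\<^sup>+x\<in>Q w. g x \<partial>\<mu>) = (\<integral>\<^sup>+x\<in>Q w. ennreal \<bar>f x\<bar> \<partial>\<mu>)"
      using Q_K[OF w] by (intro nn_integral_cong) (auto simp: g_def indicator_def)
    moreover have "ennreal t \<le> (\<integral>\<^sup>+x\<in>Q w. ennreal \<bar>f x\<bar> \<partial>\<mu>) / emeasure \<mu> (Q w)"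
      using w by (simp add: W_def less_imp_le)
    ultimately show ?thesis
      by (metis mult_right_mono divide_times_le_ennreal order_trans zero_le)
  qed
  have "ennreal t * emeasure \<mu> (\<Union>v\<in>V. Q v) \<le> (\<integral>\<^sup>+x\<in>(\<Union>v\<in>V. Q v). g x \<partial>\<mu>)"
    by (rule weak_type_UN[OF V_countable _ g_meas N_null])
      (use V_W Q_sets large in \<open>auto simp: N_def\<close>)
  also have "\<dots> \<le> (\<integral>\<^sup>+x\<in>K. ennreal \<bar>f x\<bar> \<partial>\<mu>)"
    by (intro nn_integral_mono) (auto simp: g_def indicator_def)
  finally show ?thesis
    by (simp only: level_set)
qed

theorem corollary1p3:
  fixes m :: nat
    and r :: "nat \<Rightarrow> real"
    and R :: "nat \<Rightarrow> real ^ 'd \<Rightarrow> real ^ 'd"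
    and b :: "nat \<Rightarrow> real ^ 'd"
    and S :: "nat \<Rightarrow> real ^ 'd \<Rightarrow> real ^ 'd"
    and K :: "(real ^ 'd) set"
    and p :: "nat \<Rightarrow> real"
    and \<mu> :: "(real ^ 'd) measure"
    and f :: "real ^ 'd \<Rightarrow> real"
    and t :: real
  assumes ratio: "\<And>i. i \<in> {1..m} \<Longrightarrow> 0 < r i \<and> r i < 1"
    and orthogonal: "\<And>i. i \<in> {1..m} \<Longrightarrow> orthogonal_transformation (R i)"
    and similitude: "\<And>i x. i \<in> {1..m} \<Longrightarrow> S i x = r i *\<^sub>R R i x + b i"
    and no_common_fixed_point: "\<not> (\<exists>x. \<forall>i\<in>{1..m}. S i x = x)"
    and attractor: "self_similar_set m S K"
    and weights_pos: "\<And>i. i \<in> {1..m} \<Longrightarrow> 0 < p i"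
    and weights_sum: "(\<Sum>i\<in>{1..m}. p i) = 1"
    and invariant: "self_similar_measure m S p \<mu>"
    and pcf: "post_critically_finite m S K"
    and integrable: "set_integrable \<mu> K f"
    and t_pos: "0 < t"
  shows "measure \<mu> {x \<in> K. maximal_operator m S K \<mu> f x > ennreal t}
           \<le> 4 / t * (LINT x:K|\<mu>. \<bar>f x\<bar>)"
proof -
  define c where "c = Max (r ` {1..m})"
  have "{1..m} \<noteq> {}"
    using weights_sum by force
  then have c_in: "c \<in> r ` {1..m}"
    unfolding c_def by (intro Max_in) auto
  have r_le: "r i \<le> c" if "i \<in> {1..m}" for i
    unfolding c_def using that by (intro Max_ge) auto
  have dist_S: "dist (S i x) (S i y) = r i * dist x y" if i: "i \<in> {1..m}" for i x y
  proof -
    have "S i x - S i y = r i *\<^sub>R R i (x - y)"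
      using orthogonal[OF i]
      by (simp add: similitude[OF i] orthogonal_transformation_linear linear_diff scaleR_diff_right)
    then show ?thesis
      using ratio[OF i] orthogonal[OF i] by (simp add: dist_norm orthogonal_transformation_norm)
  qed
  interpret contracting_system m S K c
  proof
    show "0 \<le> c" "c < 1"
      using c_in ratio by (auto simp: less_imp_le)
    show "dist (S i x) (S i y) \<le> c * dist x y" if "i \<in> {1..m}" for i x y
      using that by (simp add: dist_S r_le mult_right_mono)
    show "inj (S i)" if "i \<in> {1..m}" for i
    proof (rule injI)
      fix x y assume "S i x = S i y"
      then have "r i * dist x y = 0"
        using dist_S[OF that, of x y] by simp
      then show "x = y"
        using ratio[OF that] by simp
    qed
  qed (rule attractor)
  interpret prob_space \<mu>
    using invariant by (simp add: self_similar_measure_def)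
  have sets: "sets \<mu> = sets borel"
    using invariant by (simp add: self_similar_measure_def)
  have "emeasure \<mu> {x} = 0" for x
    using self_similar_measure_singleton[OF weights_pos weights_sum invariant no_common_fixed_point]
    by (simp add: emeasure_eq_measure)
  moreover have "set_borel_measurable \<mu> K f"
    using integrable by (auto simp: set_integrable_def set_borel_measurable_def)
  ultimately have "ennreal t * emeasure \<mu> {x \<in> K. maximal_operator m S K \<mu> f x > ennreal t}
      \<le> (\<integral>\<^sup>+x\<in>K. ennreal \<bar>f x\<bar> \<partial>\<mu>)"
    using maximal_operator_weak_type[OF pcf sets] by blast
  also have "\<dots> = (\<integral>\<^sup>+x. ennreal (indicator K x *\<^sub>R \<bar>f x\<bar>) \<partial>\<mu>)"
    by (intro nn_integral_cong) (auto simp: indicator_def)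
  also have "\<dots> = ennreal (LINT x:K|\<mu>. \<bar>f x\<bar>)"
    unfolding set_lebesgue_integral_def
    using set_integrable_abs[OF integrable]
    by (intro nn_integral_eq_integral) (auto simp: set_integrable_def)
  finally have "ennreal (t * measure \<mu> {x \<in> K. maximal_operator m S K \<mu> f x > ennreal t})
      \<le> ennreal (LINT x:K|\<mu>. \<bar>f x\<bar>)"
    using t_pos by (simp add: emeasure_eq_measure ennreal_mult)
  moreover have nonneg: "0 \<le> (LINT x:K|\<mu>. \<bar>f x\<bar>)"
    unfolding set_lebesgue_integral_def by (intro integral_nonneg_AE) simp
  ultimately have "t * measure \<mu> {x \<in> K. maximal_operator m S K \<mu> f x > ennreal t}
      \<le> (LINT x:K|\<mu>. \<bar>f x\<bar>)"
    by simp
  also have "\<dots> \<le> 4 * (LINT x:K|\<mu>. \<bar>f x\<bar>)"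
    using nonneg by simp
  finally show ?thesis
    using t_pos by (simp add: field_simps)
qed

end
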